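(* Let $\alpha\in F$. Then $\alpha$ is Dirichlet $\varepsilon$-improvable for some $0<\varepsilon\leq\frac1e$ if and only if $\alpha\in\mathbb{F}_q(T)$.
   Context: Let $q$ be a prime power, $\Lambda=\mathbb{F}_q[T]$ and $F=\mathbb{F}_q((T^{-1}))$. For nonzero $a=\sum_{j\leq j_0}a_jT^j\in F$ with $a_{j_0}\neq 0$, $|a|=e^{j_0}$; $|0|=0$. For $0<\varepsilon\leq\frac1e$, $\alpha\in F$ is called Dirichlet $\varepsilon$-improvable if there exists $N_0\in\mathbb{N}$ such that for every $n\geq N_0$ there exist $p,q\in\Lambda$ with $|q\alpha-p|<\frac{\varepsilon}{e^n}$ and $1\leq|q|<\varepsilon e^n$. *)

theory Defs
  imports Complex_Main "HOL-Computational_Algebra.Computational_Algebra"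
begin

text \<open>
  For a finite field \<open>'a\<close> with \<open>q\<close> elements, the field of formal Laurent series in the inverse
  of \<open>T\<close> over \<open>'a\<close> is the type \<open>'a fls\<close>, whose variable \<^const>\<open>fls_X\<close> stands for the inverse
  of \<open>T\<close>; thus \<open>T\<close> itself is \<^const>\<open>fls_X_inv\<close>, and the coefficient of the \<open>j\<close>-th power of \<open>T\<close>
  in \<open>a\<close> is \<open>fls_nth a (- j)\<close>.
\<close>

definition T_poly :: "'a::field poly \<Rightarrow> 'a fls" where
  "T_poly p = poly (map_poly fls_const p) fls_X_inv"

definition T_ratfuns :: "'a::field fls set" where
  "T_ratfuns = {T_poly p / T_poly q | p q. q \<noteq> 0}"

text \<open>
  The largest \<open>j\<close> with nonzero coefficient of the \<open>j\<close>-th power of \<open>T\<close> is \<open>- fls_subdegree a\<close>.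
\<close>

definition T_abs :: "'a::field fls \<Rightarrow> real" where
  "T_abs a = (if a = 0 then 0 else exp (- of_int (fls_subdegree a)))"

definition dirichlet_improvable :: "real \<Rightarrow> 'a::field fls \<Rightarrow> bool" where
  "dirichlet_improvable \<epsilon> \<alpha> \<longleftrightarrow>
     (\<exists>N0::nat. \<forall>n\<ge>N0. \<exists>p q :: 'a poly.
        T_abs (T_poly q * \<alpha> - T_poly p) < \<epsilon> / exp 1 ^ n \<and>
        1 \<le> T_abs (T_poly q) \<and> T_abs (T_poly q) < \<epsilon> * exp 1 ^ n)"

lemma T_poly_0 [simp]: "T_poly 0 = 0"
  by (simp add: T_poly_def)

lemma T_poly_pCons: "T_poly (pCons c p) = fls_const c + fls_X_inv * T_poly p"
  by (simp add: T_poly_def map_poly_pCons)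

lemma T_poly_nth: "fls_nth (T_poly p) n = (if n \<le> 0 then coeff p (nat (- n)) else 0)"
proof (induction p arbitrary: n)
  case (pCons c p)
  have "nat (- n) = Suc (nat (- 1 - n))" if "n < 0"
    using that by simp
  then show ?case
    by (auto simp: T_poly_pCons fls_X_inv_times_conv_shift pCons.IH add.commute coeff_pCons
        split: nat.splits)
qed simp

lemma T_poly_eq_0_iff [simp]: "T_poly p = 0 \<longleftrightarrow> p = 0"
proof
  assume *: "T_poly p = 0"
  have "coeff p n = 0" for n
    using T_poly_nth[of p "- int n"] * by simp
  then show "p = 0"
    by (simp add: poly_eq_iff)
qed simp

lemma T_abs_T_poly: "p \<noteq> 0 \<Longrightarrow> T_abs (T_poly p) = exp (real (degree p))"
proof -
  assume p: "p \<noteq> 0"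
  have "fls_subdegree (T_poly p) = - int (degree p)"
    by (rule fls_subdegree_eqI) (use p in \<open>auto simp: T_poly_nth coeff_eq_0\<close>)
  then show ?thesis
    using p by (simp add: T_abs_def)
qed

end

theory Submission
  imports Defs
begin

text \<open>
  If \<open>\<alpha>\<close> is improvable for some \<open>\<epsilon> \<le> 1/e\<close>, let \<open>(p\<^sub>n, q\<^sub>n)\<close> be the solution at scale \<open>n\<close>. The
  polynomial \<open>q\<^sub>n p\<^sub>n\<^sub>+\<^sub>1 - q\<^sub>n\<^sub>+\<^sub>1 p\<^sub>n\<close> equals \<open>q\<^sub>n\<^sub>+\<^sub>1 (q\<^sub>n \<alpha> - p\<^sub>n) - q\<^sub>n (q\<^sub>n\<^sub>+\<^sub>1 \<alpha> - p\<^sub>n\<^sub>+\<^sub>1)\<close>, whose absolute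
  value is at most \<open>\<epsilon>\<^sup>2 e < 1\<close> by the ultrametric inequality, so it vanishes. Hence the fraction
  \<open>p\<^sub>n / q\<^sub>n\<close> does not depend on \<open>n\<close>, and it is \<open>\<alpha>\<close> because it approximates \<open>\<alpha>\<close> to any precision.
\<close>

lemma T_poly_add: "T_poly (p + q) = T_poly p + T_poly q"
  by (rule fls_eqI) (simp add: T_poly_nth)

lemma T_poly_diff: "T_poly (p - q) = T_poly p - T_poly q"
  by (rule fls_eqI) (simp add: T_poly_nth)

lemma T_poly_smult: "T_poly (smult c p) = fls_const c * T_poly p"
  by (rule fls_eqI) (simp add: T_poly_nth)

lemma T_poly_mult: "T_poly (p * q) = T_poly p * T_poly q"
  by (induction p) (simp_all add: T_poly_add T_poly_smult T_poly_pCons algebra_simps)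

lemma T_abs_nonneg [simp]: "0 \<le> T_abs a"
  by (simp add: T_abs_def)

lemma T_abs_0 [simp]: "T_abs 0 = 0"
  by (simp add: T_abs_def)

lemma T_abs_pos_iff [simp]: "0 < T_abs a \<longleftrightarrow> a \<noteq> 0"
  by (simp add: T_abs_def)

lemma T_abs_mult: "T_abs (a * b) = T_abs a * T_abs b"
  by (simp add: T_abs_def flip: exp_add)

text \<open>Subtraction cannot push the order in \<open>fls_X\<close> below the smaller of the two
  orders, and \<open>T_abs\<close> decreases in that order. Zeros are split off because
  \<open>fls_subdegree 0 = 0\<close> does not reflect \<open>T_abs 0 = 0\<close>.\<close>

lemma T_abs_diff_le: "T_abs (a - b) \<le> max (T_abs a) (T_abs b)"
proof (cases "a = 0 \<or> b = 0 \<or> a = b")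
  case False
  then have "min (fls_subdegree a) (fls_subdegree b) \<le> fls_subdegree (a - b)"
    by (intro fls_subdegree_minus) auto
  with False show ?thesis
    by (auto simp: T_abs_def max_def min_def split: if_splits)
qed (auto simp: T_abs_def)

text \<open>A nonzero polynomial has absolute value at least \<open>exp 0 = 1\<close>; this gap
  turns estimates into identities.\<close>

lemma T_poly_eq_0_if_T_abs_less_1: "T_abs (T_poly p) < 1 \<Longrightarrow> p = 0"
  by (cases "p = 0") (simp_all add: T_abs_T_poly)

lemma approximants_cross_eq:
  fixes \<alpha> :: "'a::field fls"
  assumes "T_abs (T_poly q') * T_abs (T_poly q * \<alpha> - T_poly p) < 1"
    and "T_abs (T_poly q) * T_abs (T_poly q' * \<alpha> - T_poly p') < 1"
  shows "q * p' = q' * p"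
proof -
  have "T_poly (q * p' - q' * p)
      = T_poly q' * (T_poly q * \<alpha> - T_poly p) - T_poly q * (T_poly q' * \<alpha> - T_poly p')"
    by (simp add: T_poly_diff T_poly_mult algebra_simps)
  with assms T_abs_diff_le[of "T_poly q' * (T_poly q * \<alpha> - T_poly p)"
      "T_poly q * (T_poly q' * \<alpha> - T_poly p')"]
  have "T_abs (T_poly (q * p' - q' * p)) < 1"
    by (simp add: T_abs_mult)
  then show ?thesis
    using T_poly_eq_0_if_T_abs_less_1 by fastforce
qed

lemma ratfun_if_dirichlet_improvable:
  fixes \<alpha> :: "'a::field fls"
  assumes \<epsilon>: "0 < \<epsilon>" "\<epsilon> \<le> 1 / exp 1" and imp: "dirichlet_improvable \<epsilon> \<alpha>"
  shows "\<alpha> \<in> T_ratfuns"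
proof -
  obtain N :: nat and p q :: "nat \<Rightarrow> 'a poly" where
    err: "\<And>n. n \<ge> N \<Longrightarrow> T_abs (T_poly (q n) * \<alpha> - T_poly (p n)) < \<epsilon> / exp 1 ^ n" and
    ge1: "\<And>n. n \<ge> N \<Longrightarrow> 1 \<le> T_abs (T_poly (q n))" and
    less: "\<And>n. n \<ge> N \<Longrightarrow> T_abs (T_poly (q n)) < \<epsilon> * exp 1 ^ n"
    using imp unfolding dirichlet_improvable_def by metis
  have \<epsilon>_e: "\<epsilon> * exp 1 \<le> 1"
    using \<epsilon> by (simp add: field_simps)
  have \<epsilon>1: "\<epsilon> < 1"
    using \<epsilon> by (rule_tac order.strict_trans1[of _ "1 / exp 1"]) auto
  \<comment> \<open>Bounds the denominator at scale n+1 times the error at scale n; here \<epsilon>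
    \<le> 1/e enters.\<close>
  have \<epsilon>2: "\<epsilon> * (\<epsilon> * exp 1) < 1"
    using mult_left_mono[OF \<epsilon>_e, of \<epsilon>] \<epsilon>(1) \<epsilon>1 by linarith
  \<comment> \<open>For the opposite pairing, whose bound is \<epsilon>^2 / e.\<close>
  have "\<epsilon> * \<epsilon> < 1 * exp 1"
    using \<epsilon>(1) \<epsilon>1 exp_gt_one[of "1::real"] by (intro mult_strict_mono) linarith+
  then have \<epsilon>2': "\<epsilon> * \<epsilon> < exp 1"
    by simp
  have q_nz: "q n \<noteq> 0" if "n \<ge> N" for n
    using ge1[OF that] by auto
  have cross: "q n * p (Suc n) = q (Suc n) * p n" if n: "n \<ge> N" for n
  proof (rule approximants_cross_eq)
    have "T_abs (T_poly (q (Suc n))) * T_abs (T_poly (q n) * \<alpha> - T_poly (p n))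
        \<le> (\<epsilon> * exp 1 ^ Suc n) * (\<epsilon> / exp 1 ^ n)"
      using less[of "Suc n"] err[of n] n \<epsilon> by (intro mult_mono) auto
    also have "\<dots> < 1"
      using \<epsilon>2 by (simp add: mult_ac)
    finally show "T_abs (T_poly (q (Suc n))) * T_abs (T_poly (q n) * \<alpha> - T_poly (p n)) < 1" .
    have "T_abs (T_poly (q n)) * T_abs (T_poly (q (Suc n)) * \<alpha> - T_poly (p (Suc n)))
        \<le> (\<epsilon> * exp 1 ^ n) * (\<epsilon> / exp 1 ^ Suc n)"
      using less[of n] err[of "Suc n"] n \<epsilon> by (intro mult_mono) auto
    also have "\<dots> < 1"
      using \<epsilon>2' by simp
    finally show "T_abs (T_poly (q n)) * T_abs (T_poly (q (Suc n)) * \<alpha> - T_poly (p (Suc n))) < 1" .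
  qed
  \<comment> \<open>Chains the consecutive identities back to scale \<open>N\<close>. The inductive
    step is proved after multiplication by the nonzero \<open>q n\<close>, which is then
    cancelled.\<close>
  have const: "q n * p N = q N * p n" if "n \<ge> N" for n
    using that
  proof (induction n rule: dec_induct)
    case (step n)
    have "q n * (q (Suc n) * p N) = q (Suc n) * (q n * p N)"
      by (rule mult.left_commute)
    also have "\<dots> = q N * (q (Suc n) * p n)"
      by (simp only: step.IH mult.left_commute)
    also have "\<dots> = q n * (q N * p (Suc n))"
      by (simp only: cross[OF step.hyps(1), symmetric] mult.left_commute)
    finally show ?case
      using q_nz step.hyps by simp
  qed simp
  define d where "d = T_poly (q N) * \<alpha> - T_poly (p N)"
  \<comment> \<open>By \<open>const\<close>, \<open>q n * p N\<close> may be replaced by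
    \<open>q N * p n\<close>, so \<open>d\<close> times \<open>q n\<close> is the error at scale n
    times the fixed \<open>q N\<close>; and \<open>q n\<close> has absolute value at least
    1.\<close>
  have bound: "T_abs d \<le> T_abs (T_poly (q N)) * \<epsilon> * inverse (exp 1) ^ n" if n: "n \<ge> N" for n
  proof -
    have "T_poly (q n) * d = T_poly (q n) * T_poly (q N) * \<alpha> - T_poly (q n * p N)"
      by (simp add: d_def T_poly_mult algebra_simps)
    also have "\<dots> = T_poly (q N) * (T_poly (q n) * \<alpha> - T_poly (p n))"
      unfolding const[OF n] by (simp add: T_poly_mult algebra_simps)
    finally have eq: "T_poly (q n) * d = T_poly (q N) * (T_poly (q n) * \<alpha> - T_poly (p n))" .
    have "T_abs d \<le> T_abs (T_poly (q n)) * T_abs d"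
      using mult_right_mono[OF ge1[OF n], of "T_abs d"] by simp
    also have "\<dots> = T_abs (T_poly (q N)) * T_abs (T_poly (q n) * \<alpha> - T_poly (p n))"
      by (simp add: eq flip: T_abs_mult)
    also have "\<dots> \<le> T_abs (T_poly (q N)) * (\<epsilon> / exp 1 ^ n)"
      using err[OF n] by (intro mult_left_mono) auto
    finally show ?thesis
      by (simp add: field_simps power_inverse)
  qed
  \<comment> \<open>Since \<open>d\<close> does not depend on n, geometric decay of its bound forces
    it to vanish.\<close>
  have "(\<lambda>n. T_abs (T_poly (q N)) * \<epsilon> * inverse (exp 1) ^ n) \<longlonglongrightarrow> 0"
    by (intro tendsto_mult_right_zero LIMSEQ_power_zero) (simp add: field_simps)
  then have "T_abs d \<le> 0"
    by (rule LIMSEQ_le_const) (use bound in blast)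
  then have "d = 0"
    using T_abs_pos_iff[of d] by linarith
  then have "\<alpha> = T_poly (p N) / T_poly (q N)"
    using q_nz[of N] by (simp add: d_def field_simps)
  then show ?thesis
    using q_nz[of N] unfolding T_ratfuns_def by blast
qed

text \<open>One fraction representing \<alpha> serves all large scales: its error is exactly 0, and
  its denominator has fixed size while \<epsilon> e^n grows.\<close>

lemma dirichlet_improvable_if_ratfun:
  fixes \<alpha> :: "'a::field fls"
  assumes "\<alpha> \<in> T_ratfuns" and "0 < \<epsilon>"
  shows "dirichlet_improvable \<epsilon> \<alpha>"
proof -
  obtain p q :: "'a poly" where \<alpha>: "\<alpha> = T_poly p / T_poly q" and q: "q \<noteq> 0"
    using assms(1) unfolding T_ratfuns_def by blast
  obtain N :: nat where N: "T_abs (T_poly q) / \<epsilon> < exp 1 ^ N"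
    using real_arch_pow[of "exp 1"] by auto
  show ?thesis
    unfolding dirichlet_improvable_def
  proof (intro exI allI impI conjI)
    fix n assume "N \<le> n"
    then have "(exp 1 :: real) ^ N \<le> exp 1 ^ n"
      by (intro power_increasing) auto
    with N have "T_abs (T_poly q) / \<epsilon> < exp 1 ^ n"
      by linarith
    then show "T_abs (T_poly q) < \<epsilon> * exp 1 ^ n"
      using \<open>0 < \<epsilon>\<close> by (simp add: field_simps)
    show "T_abs (T_poly q * \<alpha> - T_poly p) < \<epsilon> / exp 1 ^ n"
      using q \<open>0 < \<epsilon>\<close> by (simp add: \<alpha>)
    show "1 \<le> T_abs (T_poly q)"
      using q by (simp add: T_abs_T_poly)
  qed
qed

theorem theorem2p4:
  fixes \<alpha> :: "'a::{field,finite} fls"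
  shows "(\<exists>\<epsilon>::real. 0 < \<epsilon> \<and> \<epsilon> \<le> 1 / exp 1 \<and> dirichlet_improvable \<epsilon> \<alpha>) \<longleftrightarrow> \<alpha> \<in> T_ratfuns"
proof
  assume "\<alpha> \<in> T_ratfuns"
  then have "dirichlet_improvable (1 / exp 1) \<alpha>"
    by (rule dirichlet_improvable_if_ratfun) simp
  then show "\<exists>\<epsilon>::real. 0 < \<epsilon> \<and> \<epsilon> \<le> 1 / exp 1 \<and> dirichlet_improvable \<epsilon> \<alpha>"
    by (intro exI[of _ "1 / exp 1"]) simp
qed (use ratfun_if_dirichlet_improvable in blast)

end
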